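(* Let $\sigma$ and $\pi$ be permutations, let $m_1=(\sigma,R_1)$ and $m_2=(\sigma,R_2)$ be mesh patterns with the same underlying classical pattern $\sigma$, and regard $\pi=(\pi,\emptyset)$ as a (dominating) classical pattern. Suppose there is a box $(a,b)\in[0,|\sigma|]\times[0,|\sigma|]$ with $(a,b)\notin R_1$ such that 1. $R_2=R_1\cup\{(a,b)\}$, and 2. at least one of the five mesh patterns in the set $m_1^{(a,b)\star}$ is coincident under $\pi$ with a mesh pattern that contains $m_2$ as a subpattern. Then $m_1$ and $m_2$ are coincident under $\pi$, i.e. $\mathrm{Av}(\{\pi,m_1\})=\mathrm{Av}(\{\pi,m_2\})$.
   Context: Write $[n]=\{1,\dots,n\}$ and $[0,k]=\{0,1,\dots,k\}$. A permutation of length $n$ is a bijection of $[n]$, written in one-line notation; $|\sigma|$ is the length of $\sigma$ and $G(\sigma)=\{(i,\sigma(i)) : i\in[n]\}$ is its plot. A mesh pattern of length $k$ is a pair $p=(\tau,R)$ with $\tau$ a permutation of length $k$ (the underlying classical pattern) and $R\subseteq[0,k]\times[0,k]$; the element $(i,j)$ of $[0,k]\times[0,k]$ denotes the unit box with lower left corner $(i,j)$. An occurrence of $p$ in a permutation $\pi$ of length $n$ is a subset $\omega\subseteq G(\pi)$ for which there are order-preserving injections $\alpha,\beta:[k]\to[n]$ such that (i) $\omega=\{(\alpha(i),\beta(j)):(i,j)\in G(\tau)\}$, and (ii) with $\alpha(0)=\beta(0)=0$, $\alpha(k+1)=\beta(k+1)=n+1$ and $R_{ij}=[\alpha(i)+1,\alpha(i+1)-1]\times[\beta(j)+1,\beta(j+1)-1]$,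 one has $R_{ij}\cap G(\pi)=\emptyset$ for every $(i,j)\in R$. A permutation contains $p$ if it has an occurrence of $p$, and avoids $p$ otherwise. A classical pattern $\pi$ is identified with the mesh pattern $(\pi,\emptyset)$. $\mathrm{Av}(S)$ is the set of all permutations (of all lengths) avoiding every pattern in $S$. Two mesh patterns $p_1,p_2$ (possibly of different lengths) are coincident under $\pi$ if $\mathrm{Av}(\{\pi,p_1\})=\mathrm{Av}(\{\pi,p_2\})$. A mesh pattern $q=(\kappa,T)$ contains a mesh pattern $p=(\tau,R)$ as a subpattern if there is an occurrence $\omega\subseteq G(\kappa)$ of $p$ in the permutation $\kappa$, with associated order-preserving injections $\alpha,\beta:[|\tau|]\to[|\kappa|]$ satisfying $\omega=\{(\alpha(i),\beta(j)):(i,j)\in G(\tau)\}$ and extended by $\alpha(0)=\beta(0)=0$, $\alpha(|\tau|+1)=\beta(|\tau|+1)=|\kappa|+1$, such that moreover for every $(i,j)\in R$ all boxes $(u,v)$ with $\alpha(i)\le u\le\alpha(i+1)-1$ and $\beta(j)\le v\le\beta(j+1)-1$ (the boxes making up the region corresponding to $(i,j)$) belong to $T$. Point insertion: let $p=(\tau,R)$ be a mesh pattern of length $n$ and $(i,j)\notin R$ a box. Then $p^{(i,j)}=(\tau',R')$ is the mesh pattern of length $n+1$ where $\tau'(i+1)=j+1$; for $k\le i$, $\tau'(k)=\tau(k)$ if $\tau(k)\le j$ and $\tau(k)+1$ otherwise; for $k>i+1$, $\tau'(k)=\tau(k-1)$ if $\tau(k-1)\le j$ and $\tau(k-1)+1$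 otherwise; and $R'$ is the set of boxes $(k,\ell)\in[0,n+1]^2$ such that $(k^*,\ell^* )\in R$, where $k^*=k$ if $k\le i$, $k^*=k-1$ if $k>i$, $\ell^*=\ell$ if $\ell\le j$, $\ell^*=\ell-1$ if $\ell>j$. The set $p^{(i,j)\star}$ consists of the five mesh patterns $(\tau',R')$, $(\tau',R'\cup\{(i,j+1),(i+1,j+1)\})$, $(\tau',R'\cup\{(i+1,j),(i+1,j+1)\})$, $(\tau',R'\cup\{(i,j),(i+1,j)\})$, $(\tau',R'\cup\{(i,j),(i,j+1)\})$. *)

theory Defs
  imports "HOL-Combinatorics.Permutations"
begin

(* A permutation of length n is the pair of n and a function permuting {1..n}.  Since "permutes"
   fixes every point outside {1..n}, equality of pairs is equality of permutations.
   The empty permutation (n = 0) is included. *)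
type_synonym perm = "nat \<times> (nat \<Rightarrow> nat)"

type_synonym mesh_pattern = "perm \<times> (nat \<times> nat) set"

abbreviation plen :: "perm \<Rightarrow> nat" where
  "plen \<sigma> \<equiv> fst \<sigma>"

abbreviation papp :: "perm \<Rightarrow> nat \<Rightarrow> nat" where
  "papp \<sigma> \<equiv> snd \<sigma>"

definition is_perm :: "perm \<Rightarrow> bool" where
  "is_perm \<sigma> \<longleftrightarrow> papp \<sigma> permutes {1..plen \<sigma>}"

definition plot :: "perm \<Rightarrow> (nat \<times> nat) set" where
  "plot \<sigma> = {(i, papp \<sigma> i) | i. i \<in> {1..plen \<sigma>}}"

definition is_mesh_pattern :: "mesh_pattern \<Rightarrow> bool" where
  "is_mesh_pattern = (\<lambda>(\<tau>, R). is_perm \<tau> \<and> R \<subseteq> {0..plen \<tau>} \<times> {0..plen \<tau>})"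

definition order_preserving_inj :: "nat \<Rightarrow> nat \<Rightarrow> (nat \<Rightarrow> nat) \<Rightarrow> bool" where
  "order_preserving_inj k n \<alpha> \<longleftrightarrow> \<alpha> ` {1..k} \<subseteq> {1..n} \<and> strict_mono_on {1..k} \<alpha>"

(* The extension of \<alpha> : [k] \<rightarrow> [n] by \<alpha>(0) = 0 and \<alpha>(k + 1) = n + 1. *)
definition ext :: "nat \<Rightarrow> nat \<Rightarrow> (nat \<Rightarrow> nat) \<Rightarrow> nat \<Rightarrow> nat" where
  "ext k n \<alpha> i = (if i = 0 then 0 else if i = k + 1 then n + 1 else \<alpha> i)"

(* In the intervals below "- 1" never truncates: ext k n \<alpha> (i + 1) \<ge> 1 for i \<le> k. *)
definition region ::
  "nat \<Rightarrow> nat \<Rightarrow> (nat \<Rightarrow> nat) \<Rightarrow> (nat \<Rightarrow> nat) \<Rightarrow> nat \<Rightarrow> nat \<Rightarrow> (nat \<times> nat) set" where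
  "region k n \<alpha> \<beta> i j =
     {ext k n \<alpha> i + 1 .. ext k n \<alpha> (i + 1) - 1} \<times> {ext k n \<beta> j + 1 .. ext k n \<beta> (j + 1) - 1}"

(* The set of boxes, named by their lower left corners, that make up region k n \<alpha> \<beta> i j. *)
definition region_boxes ::
  "nat \<Rightarrow> nat \<Rightarrow> (nat \<Rightarrow> nat) \<Rightarrow> (nat \<Rightarrow> nat) \<Rightarrow> nat \<Rightarrow> nat \<Rightarrow> (nat \<times> nat) set" where
  "region_boxes k n \<alpha> \<beta> i j =
     {ext k n \<alpha> i .. ext k n \<alpha> (i + 1) - 1} \<times> {ext k n \<beta> j .. ext k n \<beta> (j + 1) - 1}"

(* \<omega> is an occurrence of p in \<pi>, with \<alpha> and \<beta> as its associated injections. *)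
definition occurrence_via ::
  "mesh_pattern \<Rightarrow> perm \<Rightarrow> (nat \<Rightarrow> nat) \<Rightarrow> (nat \<Rightarrow> nat) \<Rightarrow> (nat \<times> nat) set \<Rightarrow> bool" where
  "occurrence_via = (\<lambda>(\<tau>, R) \<pi> \<alpha> \<beta> \<omega>.
     \<omega> \<subseteq> plot \<pi> \<and>
     order_preserving_inj (plen \<tau>) (plen \<pi>) \<alpha> \<and>
     order_preserving_inj (plen \<tau>) (plen \<pi>) \<beta> \<and>
     \<omega> = {(\<alpha> i, \<beta> j) | i j. (i, j) \<in> plot \<tau>} \<and>
     (\<forall>(i, j) \<in> R. region (plen \<tau>) (plen \<pi>) \<alpha> \<beta> i j \<inter> plot \<pi> = {}))"

definition is_occurrence :: "mesh_pattern \<Rightarrow> perm \<Rightarrow> (nat \<times> nat) set \<Rightarrow> bool" where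
  "is_occurrence p \<pi> \<omega> \<longleftrightarrow> (\<exists>\<alpha> \<beta>. occurrence_via p \<pi> \<alpha> \<beta> \<omega>)"

definition contains :: "perm \<Rightarrow> mesh_pattern \<Rightarrow> bool" where
  "contains \<pi> p \<longleftrightarrow> (\<exists>\<omega>. is_occurrence p \<pi> \<omega>)"

definition avoids :: "perm \<Rightarrow> mesh_pattern \<Rightarrow> bool" where
  "avoids \<pi> p \<longleftrightarrow> \<not> contains \<pi> p"

definition classical :: "perm \<Rightarrow> mesh_pattern" where
  "classical \<pi> = (\<pi>, {})"

definition Av :: "mesh_pattern set \<Rightarrow> perm set" where
  "Av S = {\<rho>. is_perm \<rho> \<and> (\<forall>p \<in> S. avoids \<rho> p)}"

definition coincident_under :: "perm \<Rightarrow> mesh_pattern \<Rightarrow> mesh_pattern \<Rightarrow> bool" where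
  "coincident_under \<pi> p1 p2 \<longleftrightarrow> Av {classical \<pi>, p1} = Av {classical \<pi>, p2}"

definition contains_subpattern :: "mesh_pattern \<Rightarrow> mesh_pattern \<Rightarrow> bool" where
  "contains_subpattern = (\<lambda>(\<kappa>, T) (\<tau>, R).
     \<exists>\<alpha> \<beta> \<omega>. occurrence_via (\<tau>, R) \<kappa> \<alpha> \<beta> \<omega> \<and>
       (\<forall>(i, j) \<in> R. region_boxes (plen \<tau>) (plen \<kappa>) \<alpha> \<beta> i j \<subseteq> T))"

(* For i, j \<le> plen \<tau> this function fixes every point outside {1..plen \<tau> + 1}, because \<tau> fixes
   every point outside {1..plen \<tau>}. *)
definition insert_perm :: "nat \<Rightarrow> nat \<Rightarrow> perm \<Rightarrow> perm" where
  "insert_perm i j \<tau> = (plen \<tau> + 1, \<lambda>k.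
     if k = i + 1 then j + 1
     else if k \<le> i then (if papp \<tau> k \<le> j then papp \<tau> k else papp \<tau> k + 1)
     else (if papp \<tau> (k - 1) \<le> j then papp \<tau> (k - 1) else papp \<tau> (k - 1) + 1))"

definition insert_shading :: "nat \<Rightarrow> nat \<Rightarrow> nat \<Rightarrow> (nat \<times> nat) set \<Rightarrow> (nat \<times> nat) set" where
  "insert_shading n i j R =
     {(k, l) \<in> {0..n + 1} \<times> {0..n + 1}.
        (if k \<le> i then k else k - 1, if l \<le> j then l else l - 1) \<in> R}"

definition point_insertions :: "mesh_pattern \<Rightarrow> nat \<times> nat \<Rightarrow> mesh_pattern set" where
  "point_insertions = (\<lambda>(\<tau>, R) (i, j).
     let \<tau>' = insert_perm i j \<tau>; R' = insert_shading (plen \<tau>) i j R in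
     {(\<tau>', R'),
      (\<tau>', R' \<union> {(i, j + 1), (i + 1, j + 1)}),
      (\<tau>', R' \<union> {(i + 1, j), (i + 1, j + 1)}),
      (\<tau>', R' \<union> {(i, j), (i + 1, j)}),
      (\<tau>', R' \<union> {(i, j), (i, j + 1)})})"

end

theory Submission
  imports Defs
begin

text \<open>
  Only an occurrence of \<open>m2\<close> has to be found in a permutation \<open>\<rho>\<close> that avoids \<open>\<pi>\<close> and contains
  \<open>m1\<close>. If the region of \<open>(a, b)\<close> in an occurrence of \<open>m1\<close> is empty, this occurrence is one of \<open>m2\<close>.
  Otherwise, adding an arbitrary, topmost, rightmost, lowest or leftmost point of that region to
  the occurrence gives an occurrence of the respective pattern in the set of point insertions. By
  coincidence \<open>\<rho>\<close> then contains a pattern that has \<open>m2\<close> as a subpattern, hence contains \<open>m2\<close>.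
\<close>

section \<open>Order-preserving injections as strictly increasing chains of grid lines\<close>

lemma less_if_less_Suc_upto:
  fixes f :: "nat \<Rightarrow> nat"
  assumes "\<forall>i\<le>k. f i < f (Suc i)" "i < j" "j \<le> k + 1"
  shows "f i < f j"
  using assms(2,3)
proof (induction j)
  case (Suc j)
  thus ?case using assms(1) by (cases "i = j") fastforce+
qed simp

text \<open>The end values 0 and \<open>n + 1\<close> encode the range condition: a strictly
  increasing chain between them has its inner values in \<open>{1..n}\<close>. Range and
  monotonicity thus merge into one condition on consecutive indices, the form in which composition
  and point insertion are checked.\<close>

lemma order_preserving_inj_iff_ext:
  "order_preserving_inj k n \<alpha> \<longleftrightarrow> (\<forall>i\<le>k. ext k n \<alpha> i < ext k n \<alpha> (Suc i))"
proof
  assume *: "order_preserving_inj k n \<alpha>"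
  hence range: "\<alpha> i \<in> {1..n}" if "i \<in> {1..k}" for i
    using that unfolding order_preserving_inj_def by blast
  have mono: "\<alpha> i < \<alpha> (Suc i)" if "i \<in> {1..<k}" for i
    using * that by (auto simp: order_preserving_inj_def strict_mono_on_def)
  show "\<forall>i\<le>k. ext k n \<alpha> i < ext k n \<alpha> (Suc i)"
  proof (intro allI impI)
    fix i assume "i \<le> k"
    \<comment> \<open>For \<open>k = 0\<close> the single step leads directly from 0 to
      \<open>n + 1\<close>. Otherwise the first and the last step involve one end value and follow
      from the range, and the inner steps follow from monotonicity.\<close>
    then consider "i = 0" "k = 0" | "i = 0" "k > 0" | "i = k" "k > 0" | "i \<in> {1..<k}"
      by fastforce
    thus "ext k n \<alpha> i < ext k n \<alpha> (Suc i)"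
      using range[of 1] range[of k] mono[of i] by cases (auto simp: ext_def)
  qed
next
  assume step: "\<forall>i\<le>k. ext k n \<alpha> i < ext k n \<alpha> (Suc i)"
  note mono = less_if_less_Suc_upto[OF step]
  have inner: "ext k n \<alpha> i = \<alpha> i" if "i \<in> {1..k}" for i
    using that by (auto simp: ext_def)
  have "\<alpha> i \<in> {1..n}" if "i \<in> {1..k}" for i
    using mono[of 0 i] mono[of i "k + 1"] inner[OF that] that by (auto simp: ext_def)
  moreover have "\<alpha> i < \<alpha> j" if "i \<in> {1..k}" "j \<in> {1..k}" "i < j" for i j
    using mono[of i j] inner that by auto
  ultimately show "order_preserving_inj k n \<alpha>"
    by (auto simp: order_preserving_inj_def strict_mono_on_def)
qed

lemma ext_less_ext:
  assumes "order_preserving_inj k n \<alpha>" "i < j" "j \<le> k + 1"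
  shows "ext k n \<alpha> i < ext k n \<alpha> j"
  using less_if_less_Suc_upto assms unfolding order_preserving_inj_iff_ext by blast

lemma ext_le_ext:
  assumes "order_preserving_inj k n \<alpha>" "i \<le> j" "j \<le> k + 1"
  shows "ext k n \<alpha> i \<le> ext k n \<alpha> j"
  using ext_less_ext[OF assms(1), of i j] assms by (cases "i = j") auto

lemma ext_less_ext_iff:
  assumes "order_preserving_inj k n \<alpha>" "i \<le> k + 1" "j \<le> k + 1"
  shows "ext k n \<alpha> i < ext k n \<alpha> j \<longleftrightarrow> i < j"
  using ext_less_ext[OF assms(1), of i j] ext_le_ext[OF assms(1), of j i] assms
  by (cases "i < j") auto

lemma ext_le_Suc:
  assumes "order_preserving_inj k n \<alpha>" "i \<le> k + 1"
  shows "ext k n \<alpha> i \<le> n + 1"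
  using ext_le_ext[OF assms(1), of i "k + 1"] assms by (simp add: ext_def)

lemma ext_inner: "i \<in> {1..k} \<Longrightarrow> ext k n \<alpha> i = \<alpha> i"
  by (auto simp: ext_def)

section \<open>Membership in regions and plots\<close>

lemma mem_region_iff:
  "(x, y) \<in> region k n \<alpha> \<beta> i j \<longleftrightarrow>
     ext k n \<alpha> i < x \<and> x < ext k n \<alpha> (i + 1) \<and> ext k n \<beta> j < y \<and> y < ext k n \<beta> (j + 1)"
  by (auto simp: region_def)

lemma mem_plot_iff: "(x, y) \<in> plot \<sigma> \<longleftrightarrow> x \<in> {1..plen \<sigma>} \<and> y = papp \<sigma> x"
  by (auto simp: plot_def)

lemma finite_plot: "finite (plot \<sigma>)"
  by (simp add: plot_def)

lemma plot_range: "is_perm \<sigma> \<Longrightarrow> (x, y) \<in> plot \<sigma> \<Longrightarrow> y \<in> {1..plen \<sigma>}"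
  using permutes_in_image[of "papp \<sigma>" "{1..plen \<sigma>}" x] by (auto simp: is_perm_def mem_plot_iff)

lemma plot_surj:
  assumes "is_perm \<sigma>" "y \<in> {1..plen \<sigma>}"
  shows "\<exists>x. (x, y) \<in> plot \<sigma>"
proof -
  have "y \<in> papp \<sigma> ` {1..plen \<sigma>}"
    using assms permutes_image unfolding is_perm_def by blast
  thus ?thesis unfolding mem_plot_iff by blast
qed

lemma plot_inj:
  assumes "is_perm \<sigma>" "(x, y) \<in> plot \<sigma>" "(x', y) \<in> plot \<sigma>"
  shows "x = x'"
proof -
  have "inj (papp \<sigma>)" using assms(1) permutes_inj unfolding is_perm_def by blast
  thus ?thesis using assms(2,3) unfolding mem_plot_iff by (metis injD)
qed

section \<open>Containment in terms of the two injections\<close>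

text \<open>The set \<omega> is determined by \<alpha> and \<beta> as the image of the plot of
  \<tau>, so it can be eliminated; its inclusion in the plot of \<rho> becomes a condition on single
  points.\<close>

lemma contains_iff:
  "contains \<rho> (\<tau>, R) \<longleftrightarrow>
    (\<exists>\<alpha> \<beta>. order_preserving_inj (plen \<tau>) (plen \<rho>) \<alpha> \<and> order_preserving_inj (plen \<tau>) (plen \<rho>) \<beta> \<and>
      (\<forall>(i, j) \<in> plot \<tau>. (\<alpha> i, \<beta> j) \<in> plot \<rho>) \<and>
      (\<forall>(i, j) \<in> R. region (plen \<tau>) (plen \<rho>) \<alpha> \<beta> i j \<inter> plot \<rho> = {}))"
proof -
  have "{(\<alpha> i, \<beta> j) | i j. (i, j) \<in> plot \<tau>} \<subseteq> plot \<rho> \<longleftrightarrow> (\<forall>(i, j) \<in> plot \<tau>. (\<alpha> i, \<beta> j) \<in> plot \<rho>)"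
    for \<alpha> \<beta> by auto
  moreover have "(\<exists>\<omega> \<alpha> \<beta>. P \<omega> \<and> A \<alpha> \<and> B \<beta> \<and> \<omega> = X \<alpha> \<beta> \<and> C \<alpha> \<beta>) \<longleftrightarrow>
      (\<exists>\<alpha> \<beta>. A \<alpha> \<and> B \<beta> \<and> P (X \<alpha> \<beta>) \<and> C \<alpha> \<beta>)"
    for P A B C and X :: "(nat \<Rightarrow> nat) \<Rightarrow> (nat \<Rightarrow> nat) \<Rightarrow> (nat \<times> nat) set" by blast
  ultimately show ?thesis
    unfolding contains_def is_occurrence_def occurrence_via_def prod.case by presburger
qed

lemma containsI:
  assumes "order_preserving_inj (plen \<tau>) (plen \<rho>) \<alpha>" "order_preserving_inj (plen \<tau>) (plen \<rho>) \<beta>"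
    and "\<And>i j. (i, j) \<in> plot \<tau> \<Longrightarrow> (\<alpha> i, \<beta> j) \<in> plot \<rho>"
    and "\<And>i j. (i, j) \<in> R \<Longrightarrow> region (plen \<tau>) (plen \<rho>) \<alpha> \<beta> i j \<inter> plot \<rho> = {}"
  shows "contains \<rho> (\<tau>, R)"
  unfolding contains_iff
  by (intro exI[of _ \<alpha>] exI[of _ \<beta>]) (use assms in \<open>simp only: Ball_def split_paired_All prod.case\<close>, simp)

lemma containsE:
  assumes "contains \<rho> (\<tau>, R)"
  obtains \<alpha> \<beta>
  where "order_preserving_inj (plen \<tau>) (plen \<rho>) \<alpha>" "order_preserving_inj (plen \<tau>) (plen \<rho>) \<beta>"
    and "\<And>i j. (i, j) \<in> plot \<tau> \<Longrightarrow> (\<alpha> i, \<beta> j) \<in> plot \<rho>"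
    and "\<And>i j. (i, j) \<in> R \<Longrightarrow> region (plen \<tau>) (plen \<rho>) \<alpha> \<beta> i j \<inter> plot \<rho> = {}"
proof -
  from assms obtain \<alpha> \<beta>
    where *: "order_preserving_inj (plen \<tau>) (plen \<rho>) \<alpha>" "order_preserving_inj (plen \<tau>) (plen \<rho>) \<beta>"
      "\<forall>(i, j) \<in> plot \<tau>. (\<alpha> i, \<beta> j) \<in> plot \<rho>"
      "\<forall>(i, j) \<in> R. region (plen \<tau>) (plen \<rho>) \<alpha> \<beta> i j \<inter> plot \<rho> = {}"
    unfolding contains_iff by (elim exE conjE)
  show thesis
    by (rule that[OF *(1,2)]) (use *(3,4) in \<open>simp_all only: Ball_def split_paired_All prod.case\<close>)
qed

lemma contains_antimono:
  assumes "contains \<rho> (\<tau>, R')" "R \<subseteq> R'"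
  shows "contains \<rho> (\<tau>, R)"
  using assms(1)
proof (rule containsE)
  fix \<alpha> \<beta>
  assume "order_preserving_inj (plen \<tau>) (plen \<rho>) \<alpha>" "order_preserving_inj (plen \<tau>) (plen \<rho>) \<beta>"
    "\<And>i j. (i, j) \<in> plot \<tau> \<Longrightarrow> (\<alpha> i, \<beta> j) \<in> plot \<rho>"
    "\<And>i j. (i, j) \<in> R' \<Longrightarrow> region (plen \<tau>) (plen \<rho>) \<alpha> \<beta> i j \<inter> plot \<rho> = {}"
  thus ?thesis using assms(2) by (intro containsI[of \<tau> \<rho> \<alpha> \<beta>]) (meson subsetD)+
qed

section \<open>Composition of occurrences\<close>

text \<open>End indices go to end indices under both extensions, and \<alpha> keeps inner indices
  inner, so extending commutes with composing. The grid lines of a composite occurrence are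
  therefore grid lines of the outer one.\<close>

lemma ext_comp:
  assumes "order_preserving_inj k m \<alpha>" "i \<le> k + 1"
  shows "ext k n (\<alpha>' \<circ> \<alpha>) i = ext m n \<alpha>' (ext k m \<alpha> i)"
proof -
  have "\<alpha> i \<in> {1..m}" if "i \<in> {1..k}"
    using assms(1) that unfolding order_preserving_inj_def by blast
  thus ?thesis using assms(2) by (cases "i \<in> {1..k}") (auto simp: ext_def)
qed

lemma order_preserving_inj_comp:
  assumes "order_preserving_inj k m \<alpha>" "order_preserving_inj m n \<alpha>'"
  shows "order_preserving_inj k n (\<alpha>' \<circ> \<alpha>)"
  unfolding order_preserving_inj_iff_ext
proof (intro allI impI)
  fix i assume "i \<le> k"
  thus "ext k n (\<alpha>' \<circ> \<alpha>) i < ext k n (\<alpha>' \<circ> \<alpha>) (Suc i)"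
    using assms by (simp add: ext_comp ext_less_ext ext_le_Suc[of k m \<alpha>, simplified])
qed

text \<open>The largest index \<open>u\<close> below \<open>r\<close> whose grid line does not
  exceed \<open>x\<close> decides: either \<open>x\<close> is on that line, and then
  \<open>l < u\<close> because \<open>x\<close> exceeds line \<open>l\<close>, or \<open>x\<close>
  lies strictly between that line and the next.\<close>

lemma ext_cover:
  assumes "ext k n \<alpha> l < x" "x < ext k n \<alpha> r" "l < r"
  obtains (on) u where "l < u" "u < r" "x = ext k n \<alpha> u"
    | (between) u where "l \<le> u" "u < r" "ext k n \<alpha> u < x" "x < ext k n \<alpha> (u + 1)"
proof -
  define u where "u = (GREATEST u. u < r \<and> ext k n \<alpha> u \<le> x)"
  have *: "l < r \<and> ext k n \<alpha> l \<le> x" using assms by simp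
  have u: "u < r \<and> ext k n \<alpha> u \<le> x" unfolding u_def
    by (rule GreatestI_nat[where P = "\<lambda>u. u < r \<and> ext k n \<alpha> u \<le> x" and b = r, OF *]) auto
  have lu: "l \<le> u" unfolding u_def
    by (rule Greatest_le_nat[where P = "\<lambda>u. u < r \<and> ext k n \<alpha> u \<le> x" and b = r, OF *]) auto
  have "x < ext k n \<alpha> (u + 1)"
  \<comment> \<open>If line \<open>u + 1\<close> did not exceed \<open>x\<close>, then
    \<open>u + 1\<close> would differ from \<open>r\<close>, because \<open>x\<close> is below line
    \<open>r\<close>, and would be a larger candidate than \<open>u\<close>.\<close>
  proof (rule ccontr)
    assume not: "\<not> ?thesis"
    with u assms(2) have "u + 1 < r \<and> ext k n \<alpha> (u + 1) \<le> x"
      by (metis Suc_eq_plus1 Suc_lessI not_less)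
    hence "u + 1 \<le> u" unfolding u_def
      by (rule Greatest_le_nat[where P = "\<lambda>u. u < r \<and> ext k n \<alpha> u \<le> x" and b = r]) auto
    thus False by simp
  qed
  thus thesis using on[of u] between[of u] u lu assms(1)
    by (metis le_neq_implies_less less_irrefl)
qed

lemma contains_subpatternE:
  assumes "contains_subpattern (\<kappa>, T) (\<tau>, R)"
  obtains \<alpha> \<beta>
  where "order_preserving_inj (plen \<tau>) (plen \<kappa>) \<alpha>" "order_preserving_inj (plen \<tau>) (plen \<kappa>) \<beta>"
    and "\<And>i j. (i, j) \<in> plot \<tau> \<Longrightarrow> (\<alpha> i, \<beta> j) \<in> plot \<kappa>"
    and "\<And>i j. (i, j) \<in> R \<Longrightarrow> region (plen \<tau>) (plen \<kappa>) \<alpha> \<beta> i j \<inter> plot \<kappa> = {}"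
    and "\<And>i j. (i, j) \<in> R \<Longrightarrow> region_boxes (plen \<tau>) (plen \<kappa>) \<alpha> \<beta> i j \<subseteq> T"
proof -
  from assms obtain \<alpha> \<beta> \<omega>
    where *: "\<omega> \<subseteq> plot \<kappa>" "order_preserving_inj (plen \<tau>) (plen \<kappa>) \<alpha>"
      "order_preserving_inj (plen \<tau>) (plen \<kappa>) \<beta>"
      "\<omega> = {(\<alpha> i, \<beta> j) | i j. (i, j) \<in> plot \<tau>}"
      "\<forall>(i, j) \<in> R. region (plen \<tau>) (plen \<kappa>) \<alpha> \<beta> i j \<inter> plot \<kappa> = {}"
      "\<forall>(i, j) \<in> R. region_boxes (plen \<tau>) (plen \<kappa>) \<alpha> \<beta> i j \<subseteq> T"
    unfolding contains_subpattern_def occurrence_via_def prod.case by (elim exE conjE)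
  show thesis
  proof (rule that[OF *(2,3)])
    show "(\<alpha> i, \<beta> j) \<in> plot \<kappa>" if "(i, j) \<in> plot \<tau>" for i j
      using *(1,4) that by blast
  qed (use *(5,6) in \<open>simp_all only: Ball_def split_paired_All prod.case\<close>)
qed

text \<open>
  A point in a shaded region of the composite occurrence either lies inside a single box of \<open>q\<close>,
  which is shaded, or on a grid line of \<open>q\<close>; in the latter case it belongs to the occurrence of \<open>q\<close>
  and comes from a point of \<open>\<kappa>\<close> in a region that the occurrence of \<open>p\<close> in \<open>\<kappa>\<close> leaves empty.
\<close>

lemma contains_subpattern_trans:
  assumes \<rho>: "is_perm \<rho>" and q: "is_mesh_pattern q" and p: "is_mesh_pattern p"
    and cont: "contains \<rho> q" and sub: "contains_subpattern q p"
  shows "contains \<rho> p"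
proof -
  obtain \<kappa> T \<tau> R where qp: "q = (\<kappa>, T)" "p = (\<tau>, R)" by fastforce
  let ?k = "plen \<tau>" and ?m = "plen \<kappa>" and ?n = "plen \<rho>"
  have \<kappa>: "is_perm \<kappa>" and R: "R \<subseteq> {0..plen \<tau>} \<times> {0..plen \<tau>}"
    using q p qp by (auto simp: is_mesh_pattern_def)
  obtain \<alpha>' \<beta>' where \<alpha>': "order_preserving_inj ?m ?n \<alpha>'" and \<beta>': "order_preserving_inj ?m ?n \<beta>'"
    and plot': "\<And>i j. (i, j) \<in> plot \<kappa> \<Longrightarrow> (\<alpha>' i, \<beta>' j) \<in> plot \<rho>"
    and empty': "\<And>i j. (i, j) \<in> T \<Longrightarrow> region ?m ?n \<alpha>' \<beta>' i j \<inter> plot \<rho> = {}"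
    using cont unfolding qp by (rule containsE)
      (rule that, assumption, assumption, blast, blast)
  obtain \<alpha> \<beta> where \<alpha>: "order_preserving_inj ?k ?m \<alpha>" and \<beta>: "order_preserving_inj ?k ?m \<beta>"
    and plot: "\<And>i j. (i, j) \<in> plot \<tau> \<Longrightarrow> (\<alpha> i, \<beta> j) \<in> plot \<kappa>"
    and empty: "\<And>i j. (i, j) \<in> R \<Longrightarrow> region ?k ?m \<alpha> \<beta> i j \<inter> plot \<kappa> = {}"
    and boxes: "\<And>i j. (i, j) \<in> R \<Longrightarrow> region_boxes ?k ?m \<alpha> \<beta> i j \<subseteq> T"
    using sub unfolding qp by (rule contains_subpatternE)
      (rule that, assumption, assumption, blast, blast, blast)
  have "(x, y) \<notin> plot \<rho>"
    if ij: "(i, j) \<in> R" and xy: "(x, y) \<in> region ?k ?n (\<alpha>' \<circ> \<alpha>) (\<beta>' \<circ> \<beta>) i j" for i j x y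
  proof
    assume xy_plot: "(x, y) \<in> plot \<rho>"
    have ij_le: "i \<le> ?k" "j \<le> ?k" using ij R by auto
    \<comment> \<open>These bound the region of \<open>(i, j)\<close> in \<kappa>; read as indices,
      they name the grid lines of the outer occurrence that bound the composite region.\<close>
    define l r b t where "l = ext ?k ?m \<alpha> i" and "r = ext ?k ?m \<alpha> (i + 1)"
      and "b = ext ?k ?m \<beta> j" and "t = ext ?k ?m \<beta> (j + 1)"
    have lr: "l < r" "r \<le> ?m + 1" and bt: "b < t" "t \<le> ?m + 1"
      using ij_le ext_less_ext[OF \<alpha>, of i "i + 1"] ext_less_ext[OF \<beta>, of j "j + 1"]
        ext_le_Suc[OF \<alpha>, of "i + 1"] ext_le_Suc[OF \<beta>, of "j + 1"]
      by (auto simp: l_def r_def b_def t_def)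
    have x: "ext ?m ?n \<alpha>' l < x" "x < ext ?m ?n \<alpha>' r"
      and y: "ext ?m ?n \<beta>' b < y" "y < ext ?m ?n \<beta>' t"
      using xy ij_le by (auto simp: mem_region_iff ext_comp[OF \<alpha>] ext_comp[OF \<beta>]
          l_def r_def b_def t_def)
    have inside: False if "(u, v) \<in> plot \<kappa>" "l < u" "u < r" "b < v" "v < t" for u v
    proof -
      have "(u, v) \<in> region ?k ?m \<alpha> \<beta> i j"
        using that by (simp add: mem_region_iff l_def r_def b_def t_def)
      thus False using empty[OF ij] that(1) by blast
    qed
    \<comment> \<open>Both sides hold, since \<open>(x, y)\<close> lies in the composite region and
      the outer extensions reflect the order. The equivalence lets bounds on one coordinate of a
      point of \<kappa> yield those on the other.\<close>
    have iff: "l < u \<and> u < r \<longleftrightarrow> b < v \<and> v < t"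
      if "(u, v) \<in> plot \<kappa>" "x = \<alpha>' u" "y = \<beta>' v" for u v
    proof -
      have "u \<in> {1..?m}" "v \<in> {1..?m}"
        using that \<kappa> plot_range[of \<kappa> u v] by (auto simp: mem_plot_iff)
      thus ?thesis
        using x y lr bt that ext_less_ext_iff[OF \<alpha>', of l u] ext_less_ext_iff[OF \<alpha>', of u r]
          ext_less_ext_iff[OF \<beta>', of b v] ext_less_ext_iff[OF \<beta>', of v t]
        by (simp add: ext_inner)
    qed
    show False
      using x lr(1)
    proof (cases rule: ext_cover)
      case (on u)
      have u: "u \<in> {1..?m}" using on lr by auto
      hence "(u, papp \<kappa> u) \<in> plot \<kappa>" by (simp add: mem_plot_iff)
      moreover from plot'[OF this] have "y = \<beta>' (papp \<kappa> u)"
        using xy_plot on u by (simp add: mem_plot_iff ext_inner)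
      moreover have "x = \<alpha>' u" using on u by (simp add: ext_inner)
      ultimately show False using iff inside on by blast
    next
      case u: (between u)
      show False
        using y bt(1)
      proof (cases rule: ext_cover)
        case (on v)
        have v: "v \<in> {1..?m}" using on bt by auto
        \<comment> \<open>On a horizontal line the point is found by its value: \<kappa> has a point
          in row \<open>v\<close>, and its image is \<open>(x, y)\<close> because \<rho> has only
          one point in row \<open>y\<close>.\<close>
        then obtain u' where u': "(u', v) \<in> plot \<kappa>"
          using \<kappa> plot_surj by blast
        have yv: "y = \<beta>' v" using on v by (simp add: ext_inner)
        hence "x = \<alpha>' u'" using plot'[OF u'] xy_plot \<rho> plot_inj by blast
        thus False using iff[OF u'] inside[OF u'] on yv by blast
      next
        case v: (between v)
        have "(u, v) \<in> region_boxes ?k ?m \<alpha> \<beta> i j"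
          using u v by (auto simp: region_boxes_def l_def r_def b_def t_def)
        hence "(u, v) \<in> T" using boxes[OF ij] by blast
        moreover have "(x, y) \<in> region ?m ?n \<alpha>' \<beta>' u v"
          using u v by (simp add: mem_region_iff)
        ultimately show False using empty' xy_plot by blast
      qed
    qed
  qed
  hence "region ?k ?n (\<alpha>' \<circ> \<alpha>) (\<beta>' \<circ> \<beta>) i j \<inter> plot \<rho> = {}" if "(i, j) \<in> R" for i j
    using that by (intro equals0I) auto
  moreover have "((\<alpha>' \<circ> \<alpha>) i, (\<beta>' \<circ> \<beta>) j) \<in> plot \<rho>" if "(i, j) \<in> plot \<tau>" for i j
    using plot plot' that by simp
  ultimately show ?thesis
    using order_preserving_inj_comp[OF \<alpha> \<alpha>'] order_preserving_inj_comp[OF \<beta> \<beta>']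
    unfolding qp by (intro containsI)
qed

section \<open>Adding a point to an occurrence\<close>

text \<open>The new value \<open>x\<close> gets index \<open>a + 1\<close> and later indices move up
  by one. The same operation serves for the injections and for their extensions.\<close>

definition insert_at :: "nat \<Rightarrow> nat \<Rightarrow> (nat \<Rightarrow> nat) \<Rightarrow> nat \<Rightarrow> nat" where
  "insert_at a x \<alpha> c = (if c \<le> a then \<alpha> c else if c = a + 1 then x else \<alpha> (c - 1))"

text \<open>The index shift is the one that \<open>insert_perm\<close> applies to old positions and
  values, so the old points of an occurrence keep their places.\<close>

lemma insert_at_old: "insert_at a x f (if i \<le> a then i else i + 1) = f i"
  by (simp add: insert_at_def)

text \<open>The new line \<open>x\<close> cuts the interval from \<open>f a\<close> to
  \<open>f (a + 1)\<close> in two; \<open>i = a\<close> is the half below \<open>x\<close> and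
  \<open>i = a + 1\<close> the half above.\<close>

lemma insert_at_split:
  assumes "insert_at a x f i < u" "u < insert_at a x f (i + 1)" "i \<in> {a, a + 1}"
    and "f a < x" "x < f (a + 1)"
  shows "f a < u" "u < f (a + 1)" "if i = a then u < x else x < u"
  using assms by (auto simp: insert_at_def)

text \<open>Since \<open>a \<le> k\<close>, the new index \<open>a + 1\<close> is neither 0 nor the
  last index \<open>k + 2\<close>, so both end values stay in place.\<close>

lemma ext_insert_at:
  assumes "a \<le> k"
  shows "ext (k + 1) n (insert_at a x \<alpha>) c = insert_at a x (ext k n \<alpha>) c"
  using assms by (auto simp: ext_def insert_at_def)

lemma order_preserving_inj_insert_at:
  assumes "order_preserving_inj k n \<alpha>" "a \<le> k" "ext k n \<alpha> a < x" "x < ext k n \<alpha> (a + 1)"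
  shows "order_preserving_inj (k + 1) n (insert_at a x \<alpha>)"
  unfolding order_preserving_inj_iff_ext
proof (intro allI impI)
  fix i assume "i \<le> k + 1"
  moreover consider "i < a" | "i = a" | "i = a + 1" | "i > a + 1" by linarith
  ultimately show "ext (k + 1) n (insert_at a x \<alpha>) i < ext (k + 1) n (insert_at a x \<alpha>) (Suc i)"
    unfolding ext_insert_at[OF assms(2)]
    using assms ext_less_ext[OF assms(1), of i "i + 1"] ext_less_ext[OF assms(1), of "i - 1" i]
    by cases (auto simp: insert_at_def)
qed

lemma plot_insert_perm:
  assumes "a \<le> plen \<tau>" "(i, j) \<in> plot (insert_perm a b \<tau>)"
  shows "(i, j) = (a + 1, b + 1) \<or>
    (\<exists>(i', j') \<in> plot \<tau>. i = (if i' \<le> a then i' else i' + 1) \<and> j = (if j' \<le> b then j' else j' + 1))"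
proof -
  consider "i = a + 1" | "i \<le> a" | "i > a + 1" by linarith
  thus ?thesis
  proof cases
    case 1 thus ?thesis using assms by (simp add: insert_perm_def mem_plot_iff)
  next
    case 2
    with assms show ?thesis
      by (intro disjI2 bexI[of _ "(i, papp \<tau> i)"]) (auto simp: insert_perm_def mem_plot_iff)
  next
    case 3
    with assms show ?thesis
      by (intro disjI2 bexI[of _ "(i - 1, papp \<tau> (i - 1))"])
        (auto simp: insert_perm_def mem_plot_iff)
  qed
qed

text \<open>Refining the grid puts each new box inside the old box from which
  \<open>insert_shading\<close> inherits its shading, so inherited boxes are empty automatically.
  Only the additional boxes in \<open>E\<close> need a separate argument.\<close>

lemma contains_insertion:
  assumes \<alpha>: "order_preserving_inj (plen \<tau>) (plen \<rho>) \<alpha>"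
    and \<beta>: "order_preserving_inj (plen \<tau>) (plen \<rho>) \<beta>"
    and plot: "\<And>i j. (i, j) \<in> plot \<tau> \<Longrightarrow> (\<alpha> i, \<beta> j) \<in> plot \<rho>"
    and empty: "\<And>i j. (i, j) \<in> R \<Longrightarrow> region (plen \<tau>) (plen \<rho>) \<alpha> \<beta> i j \<inter> plot \<rho> = {}"
    and ab: "a \<le> plen \<tau>" "b \<le> plen \<tau>"
    and xy: "(x, y) \<in> region (plen \<tau>) (plen \<rho>) \<alpha> \<beta> a b" "(x, y) \<in> plot \<rho>"
    and extra: "\<And>i j. (i, j) \<in> E \<Longrightarrow>
      region (plen \<tau> + 1) (plen \<rho>) (insert_at a x \<alpha>) (insert_at b y \<beta>) i j \<inter> plot \<rho> = {}"
  shows "contains \<rho> (insert_perm a b \<tau>, insert_shading (plen \<tau>) a b R \<union> E)"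
proof -
  let ?\<alpha> = "insert_at a x \<alpha>" and ?\<beta> = "insert_at b y \<beta>"
  have len: "plen (insert_perm a b \<tau>) = plen \<tau> + 1" by (simp add: insert_perm_def)
  have "order_preserving_inj (plen \<tau> + 1) (plen \<rho>) ?\<alpha>"
    "order_preserving_inj (plen \<tau> + 1) (plen \<rho>) ?\<beta>"
    using \<alpha> \<beta> ab xy(1) by (auto simp: mem_region_iff intro: order_preserving_inj_insert_at[simplified])
  moreover have "(?\<alpha> i, ?\<beta> j) \<in> plot \<rho>" if "(i, j) \<in> plot (insert_perm a b \<tau>)" for i j
    using plot_insert_perm[OF ab(1) that]
  proof
    assume "(i, j) = (a + 1, b + 1)"
    thus ?thesis using xy(2) by (simp add: insert_at_def)
  next
    assume "\<exists>(i', j') \<in> plot \<tau>. i = (if i' \<le> a then i' else i' + 1) \<and>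
      j = (if j' \<le> b then j' else j' + 1)"
    then obtain i' j' where ij: "(i', j') \<in> plot \<tau>"
      "i = (if i' \<le> a then i' else i' + 1)" "j = (if j' \<le> b then j' else j' + 1)"
      by blast
    show ?thesis
      unfolding ij(2,3) insert_at_old using plot[OF ij(1)] .
  qed
  moreover have "region (plen \<tau> + 1) (plen \<rho>) ?\<alpha> ?\<beta> i j \<inter> plot \<rho> = {}"
    if "(i, j) \<in> insert_shading (plen \<tau>) a b R" for i j
  proof -
    let ?i = "if i \<le> a then i else i - 1" and ?j = "if j \<le> b then j else j - 1"
    have "region (plen \<tau> + 1) (plen \<rho>) ?\<alpha> ?\<beta> i j \<subseteq> region (plen \<tau>) (plen \<rho>) \<alpha> \<beta> ?i ?j"
    proof -
      \<comment> \<open>The claim for one coordinate, general enough to serve for columns with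
        \<open>x\<close> and for rows with \<open>y\<close>: the two halves of interval
        \<open>e\<close> merge again, and every other interval is only renumbered.\<close>
      have shrink: "ext k n \<gamma> (if c \<le> e then c else c - 1) < w \<and>
          w < ext k n \<gamma> ((if c \<le> e then c else c - 1) + 1)"
        if "insert_at e z (ext k n \<gamma>) c < w" "w < insert_at e z (ext k n \<gamma>) (c + 1)"
          "ext k n \<gamma> e < z" "z < ext k n \<gamma> (e + 1)" for k n \<gamma> e z c and w :: nat
      proof -
        consider "c < e" | "c = e" | "c = e + 1" | "c > e + 1" by linarith
        thus ?thesis using that by cases (auto simp: insert_at_def)
      qed
      show ?thesis
      proof
        fix w assume w: "w \<in> region (plen \<tau> + 1) (plen \<rho>) ?\<alpha> ?\<beta> i j"
        obtain u v where uv: "w = (u, v)" by fastforce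
        show "w \<in> region (plen \<tau>) (plen \<rho>) \<alpha> \<beta> ?i ?j"
          using w xy(1) shrink[of a x _ _ \<alpha> i u] shrink[of b y _ _ \<beta> j v]
          unfolding uv mem_region_iff ext_insert_at[OF ab(1)] ext_insert_at[OF ab(2)] by metis
      qed
    qed
    moreover have "(?i, ?j) \<in> R" using that by (simp add: insert_shading_def)
    ultimately show ?thesis using empty by blast
  qed
  ultimately show ?thesis
    using extra unfolding len[symmetric] by (intro containsI[of _ _ ?\<alpha> ?\<beta>]) blast+
qed

text \<open>Each pattern with additional shading shades the two boxes on one side of the inserted
  point; choosing a point that is extreme toward that side empties both.\<close>

lemma contains_point_insertion:
  assumes \<alpha>: "order_preserving_inj (plen \<tau>) (plen \<rho>) \<alpha>"
    and \<beta>: "order_preserving_inj (plen \<tau>) (plen \<rho>) \<beta>"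
    and plot: "\<And>i j. (i, j) \<in> plot \<tau> \<Longrightarrow> (\<alpha> i, \<beta> j) \<in> plot \<rho>"
    and empty: "\<And>i j. (i, j) \<in> R \<Longrightarrow> region (plen \<tau>) (plen \<rho>) \<alpha> \<beta> i j \<inter> plot \<rho> = {}"
    and ab: "a \<le> plen \<tau>" "b \<le> plen \<tau>"
    and nonempty: "region (plen \<tau>) (plen \<rho>) \<alpha> \<beta> a b \<inter> plot \<rho> \<noteq> {}"
    and p: "p \<in> point_insertions (\<tau>, R) (a, b)"
  shows "contains \<rho> p"
proof -
  define S where "S = region (plen \<tau>) (plen \<rho>) \<alpha> \<beta> a b \<inter> plot \<rho>"
  have S: "finite S" "S \<noteq> {}" using nonempty finite_plot by (auto simp: S_def)
  have max: "\<exists>P \<in> S. \<forall>Q \<in> S. f Q \<le> f P" and min: "\<exists>P \<in> S. \<forall>Q \<in> S. f P \<le> f Q"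
    for f :: "nat \<times> nat \<Rightarrow> nat"
  proof -
    have "Max (f ` S) \<in> f ` S" "Min (f ` S) \<in> f ` S" using S by simp_all
    then obtain P P' where "P \<in> S" "f P = Max (f ` S)" "P' \<in> S" "f P' = Min (f ` S)" by force
    moreover have "f Q \<le> Max (f ` S)" "Min (f ` S) \<le> f Q" if "Q \<in> S" for Q
      using S that by simp_all
    ultimately show "\<exists>P \<in> S. \<forall>Q \<in> S. f Q \<le> f P" "\<exists>P \<in> S. \<forall>Q \<in> S. f P \<le> f Q"
      by metis+
  qed
  \<comment> \<open>A point in one of the four boxes around \<open>(x, y)\<close> belongs to
    \<open>S\<close>, on the side of \<open>(x, y)\<close> told by \<open>i = a\<close> and
    \<open>j = b\<close>. Emptiness of the boxes in \<open>E\<close> thus reduces to comparing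
    coordinates within \<open>S\<close>.\<close>
  have ins: "contains \<rho> (insert_perm a b \<tau>, insert_shading (plen \<tau>) a b R \<union> E)"
    if xy: "(x, y) \<in> S" and E: "E \<subseteq> {a, a + 1} \<times> {b, b + 1}"
      and extreme: "\<And>i j u v. (i, j) \<in> E \<Longrightarrow> (u, v) \<in> S \<Longrightarrow>
        if i = a then u < x else x < u \<Longrightarrow> if j = b then v < y else y < v \<Longrightarrow> False" for x y E
  proof (rule contains_insertion[OF \<alpha> \<beta> plot empty ab, where x = x and y = y])
    show xy': "(x, y) \<in> region (plen \<tau>) (plen \<rho>) \<alpha> \<beta> a b" "(x, y) \<in> plot \<rho>"
      using xy by (simp_all add: S_def)
    fix i j assume ij: "(i, j) \<in> E"
    hence ij': "i \<in> {a, a + 1}" "j \<in> {b, b + 1}" using E by blast+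
    show "region (plen \<tau> + 1) (plen \<rho>) (insert_at a x \<alpha>) (insert_at b y \<beta>) i j \<inter> plot \<rho> = {}"
    proof (rule equals0I, clarify)
      fix u v
      assume "(u, v) \<in> region (plen \<tau> + 1) (plen \<rho>) (insert_at a x \<alpha>) (insert_at b y \<beta>) i j"
        and uv: "(u, v) \<in> plot \<rho>"
      note box = this(1)[unfolded mem_region_iff ext_insert_at[OF ab(1)] ext_insert_at[OF ab(2)]]
      note u = insert_at_split[OF _ _ ij'(1), of x "ext (plen \<tau>) (plen \<rho>) \<alpha>" u]
        and v = insert_at_split[OF _ _ ij'(2), of y "ext (plen \<tau>) (plen \<rho>) \<beta>" v]
      have "(u, v) \<in> S"
        using u(1,2) v(1,2) box xy'(1) uv unfolding S_def mem_region_iff Int_iff by blast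
      moreover have "if i = a then u < x else x < u" "if j = b then v < y else y < v"
        using u(3) v(3) box xy'(1) unfolding mem_region_iff by blast+
      ultimately show False using extreme[OF ij] by blast
    qed
  qed
  let ?T = "insert_perm a b \<tau>" and ?R = "insert_shading (plen \<tau>) a b R"
  \<comment> \<open>The union with \<open>{}\<close> gives the pattern without additional shading
    the form that \<open>ins\<close> proves.\<close>
  consider "p = (?T, ?R \<union> {})" | "p = (?T, ?R \<union> {(a, b + 1), (a + 1, b + 1)})"
    | "p = (?T, ?R \<union> {(a + 1, b), (a + 1, b + 1)})"
    | "p = (?T, ?R \<union> {(a, b), (a + 1, b)})" | "p = (?T, ?R \<union> {(a, b), (a, b + 1)})"
    using p by (auto simp: point_insertions_def Let_def)
  thus ?thesis
  proof cases
    case 1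
    obtain x y where "(x, y) \<in> S" using S by fast
    thus ?thesis unfolding 1 by (rule ins) simp_all
  next
    case 2
    \<comment> \<open>Both added boxes have second index \<open>b + 1\<close>, so a point of
      \<open>S\<close> in them would have \<open>v > y\<close>, against maximality. The remaining
      cases differ in the direction only.\<close>
    obtain x y where xy: "(x, y) \<in> S" "\<And>u v. (u, v) \<in> S \<Longrightarrow> v \<le> y"
      using max[of snd] by fastforce
    show ?thesis
      unfolding 2
      by (rule ins[OF xy(1)]) (use xy(2) in \<open>force split: if_splits\<close>)+
  next
    case 3
    obtain x y where xy: "(x, y) \<in> S" "\<And>u v. (u, v) \<in> S \<Longrightarrow> u \<le> x"
      using max[of fst] by fastforce
    show ?thesis
      unfolding 3
      by (rule ins[OF xy(1)]) (use xy(2) in \<open>force split: if_splits\<close>)+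
  next
    case 4
    obtain x y where xy: "(x, y) \<in> S" "\<And>u v. (u, v) \<in> S \<Longrightarrow> y \<le> v"
      using min[of snd] by fastforce
    show ?thesis
      unfolding 4
      by (rule ins[OF xy(1)]) (use xy(2) in \<open>force split: if_splits\<close>)+
  next
    case 5
    obtain x y where xy: "(x, y) \<in> S" "\<And>u v. (u, v) \<in> S \<Longrightarrow> x \<le> u"
      using min[of fst] by fastforce
    show ?thesis
      unfolding 5
      by (rule ins[OF xy(1)]) (use xy(2) in \<open>force split: if_splits\<close>)+
  qed
qed

section \<open>Transfer of containment between the two shadings\<close>

theorem proposition3p9:
  fixes \<sigma> \<pi> :: perm and m1 m2 :: mesh_pattern
    and R1 R2 :: "(nat \<times> nat) set" and a b :: nat
  assumes "is_perm \<sigma>" and "is_perm \<pi>"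
    and "m1 = (\<sigma>, R1)" and "m2 = (\<sigma>, R2)"
    and "is_mesh_pattern m1" and "is_mesh_pattern m2"
    and "(a, b) \<in> {0..plen \<sigma>} \<times> {0..plen \<sigma>}" and "(a, b) \<notin> R1"
    and "R2 = R1 \<union> {(a, b)}"
    and "\<exists>p \<in> point_insertions m1 (a, b). \<exists>q. is_mesh_pattern q \<and>
           coincident_under \<pi> p q \<and> contains_subpattern q m2"
  shows "coincident_under \<pi> m1 m2"
proof -
  obtain p q where p: "p \<in> point_insertions m1 (a, b)" and q: "is_mesh_pattern q"
    and coinc: "coincident_under \<pi> p q" and sub: "contains_subpattern q m2"
    using assms(10) by blast
  have down: "contains \<rho> m1" if "contains \<rho> m2" for \<rho>
    using that contains_antimono assms(3,4,9) by blast
  have up: "contains \<rho> m2"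
    if \<rho>: "is_perm \<rho>" "avoids \<rho> (classical \<pi>)" and "contains \<rho> m1" for \<rho>
  proof -
    obtain \<alpha> \<beta> where occ: "order_preserving_inj (plen \<sigma>) (plen \<rho>) \<alpha>"
      "order_preserving_inj (plen \<sigma>) (plen \<rho>) \<beta>"
      "\<And>i j. (i, j) \<in> plot \<sigma> \<Longrightarrow> (\<alpha> i, \<beta> j) \<in> plot \<rho>"
      "\<And>i j. (i, j) \<in> R1 \<Longrightarrow> region (plen \<sigma>) (plen \<rho>) \<alpha> \<beta> i j \<inter> plot \<rho> = {}"
      using \<open>contains \<rho> m1\<close> unfolding assms(3) by (rule containsE)
      (rule that, assumption, assumption, blast, blast)
    show ?thesis
    proof (cases "region (plen \<sigma>) (plen \<rho>) \<alpha> \<beta> a b \<inter> plot \<rho> = {}")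
      case True
      \<comment> \<open>The empty region is exactly the condition that the additional box
        \<open>(a, b)\<close> imposes in \<open>m2\<close>.\<close>
      thus ?thesis unfolding assms(4,9) using occ by (intro containsI[of _ _ \<alpha> \<beta>]) fastforce+
    next
      case False
      have "contains \<rho> p"
        using contains_point_insertion[OF occ _ _ False] p assms(3,7) by auto
      \<comment> \<open>Containing \<open>p\<close> puts \<rho> outside
        \<open>Av {classical \<pi>, p}\<close>, which equals \<open>Av {classical \<pi>, q}\<close>.
        As \<rho> avoids \<pi>, it must be \<open>q\<close> that it contains.\<close>
      hence "\<rho> \<notin> Av {classical \<pi>, q}"
        using coinc by (auto simp: coincident_under_def Av_def avoids_def)
      hence "contains \<rho> q" using \<rho> by (auto simp: Av_def avoids_def)
      thus ?thesis using contains_subpattern_trans \<rho>(1) q assms(6) sub by blast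
    qed
  qed
  show ?thesis
    unfolding coincident_under_def Av_def using down up by (auto simp: avoids_def)
qed

end
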